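(* Let $f:\mathbb{R}^m\to\mathbb{R}$ be strongly convex and smooth (i.e. $\mu$-strongly convex and $M$-smooth for some $\mu,M>0$). Let $E\in\mathbb{R}^{n\times m}$ be a selection matrix, and let a dynamic interconnect with $m$ terminals be given that is admissible with respect to $E$ (see context). Let $(x^\star,y^\star)$ be a primal-dual solution pair, i.e. $y^\star\in\partial f(x^\star)$, $x^\star\in\mathcal{R}(E^\top)$, $y^\star\in\mathcal{N}(E)$. Let $(v(t),i(t),x(t),y(t))$, $t\in[0,\infty)$, be a curve in $\mathbb{R}^\sigma\times\mathbb{R}^\sigma\times\mathbb{R}^m\times\mathbb{R}^m$ satisfying, for all $t\in(0,\infty)$ (with some $e(t)\in\mathbb{R}^{\tau-1-m}$), $$y\in\partial f(x),\quad A i=\begin{bmatrix} -y \\ 0 \end{bmatrix},\quad v=A^\top\begin{bmatrix} x \\ e \end{bmatrix},\quad v_{\mathcal R}=D_{\mathcal R}i_{\mathcal R},\quad v_{\mathcal L}=D_{\mathcal L}\frac{d}{dt}i_{\mathcal L},\quad i_{\mathcal C}=D_{\mathcal C}\frac{d}{dt}v_{\mathcal C}.$$ Then $$\lim_{t\to\infty}(x(t),y(t))=(x^\star,y^\star).$$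
   Context: Optimization problem: minimize $f(x)$ subject to $x\in\mathcal{R}(E^\top)$, where $\mathcal R$ and $\mathcal N$ applied to a matrix denote range and null space. Selection matrix: given a partition $N_1,\dots,N_n$ of $\{1,\dots,m\}$, $E_{ij}=1$ if $j\in N_i$ and $E_{ij}=0$ otherwise. Dynamic interconnect: an RLC circuit with $m$ terminals and one ground node. It has $\tau\ge m+1$ nodes; nodes $1,\dots,m$ are connected to the terminals $1,\dots,m$, and node $\tau$ is ground. It has $\sigma$ components (resistors, inductors, capacitors), each with a $+$ terminal and a $-$ terminal attached to nodes. Inductances and capacitances lie in $(0,\infty)$ and resistances lie in $[0,\infty)$; a $0$-ohm resistor is an ideal wire, and loops of ideal wires are not permitted. The reduced node incidence matrix $A\in\mathbb{R}^{(\tau-1)\times\sigma}$ (ground row removed) has $A_{ij}=+1$ if node $i$ connects to the $+$ terminal of component $j$, $A_{ij}=-1$ if node $i$ connects to the $-$ terminal of component $j$, and $A_{ij}=0$ otherwise. Vectors $v,i\in\mathbb{R}^\sigma$ (component voltages and currents) are split by component type: $v=(v_{\mathcal R},v_{\mathcal L},v_{\mathcal C})$, $i=(i_{\mathcal R},i_{\mathcal L},i_{\mathcal C})$. $D_{\mathcal R},D_{\mathcal L},D_{\mathcal C}$ are the diagonal matrices of resistances, inductances and capacitances. $x\in\mathbb{R}^m$ are the terminal potentials, $y\in\mathbb{R}^m$ the currents leaving the terminals, $e\in\mathbb{R}^{\tau-1-m}$ the potentials of the non-terminal, non-ground nodes. Admissible (with respect to $E$): the set of all $(x,y)\in\mathbb{R}^m\times\mathbb{R}^m$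 for which there exist $v,i,e$ with $Ai=\begin{bmatrix} -y \\ 0 \end{bmatrix}$, $v=A^\top\begin{bmatrix} x \\ e \end{bmatrix}$, $v_{\mathcal R}=D_{\mathcal R}i_{\mathcal R}$, $v_{\mathcal L}=0$, $i_{\mathcal C}=0$ equals $\mathcal{R}(E^\top)\times\mathcal{N}(E)$. $f$ is $\mu$-strongly convex if $f-\frac{\mu}{2}\|\cdot\|^2$ is convex; $f$ is $M$-smooth if it is finite and differentiable everywhere with $\|\nabla f(x)-\nabla f(y)\|\le M\|x-y\|$ for all $x,y$. *)

theory Defs
  imports "HOL-Analysis.Analysis"
begin

definition strongly_convex :: "real \<Rightarrow> ('a::real_inner \<Rightarrow> real) \<Rightarrow> bool" where
  "strongly_convex \<mu> f \<longleftrightarrow> convex_on UNIV (\<lambda>x. f x - \<mu> / 2 * (norm x)\<^sup>2)"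

definition smooth_with :: "real \<Rightarrow> ('a::real_inner \<Rightarrow> real) \<Rightarrow> bool" where
  "smooth_with M f \<longleftrightarrow>
     (\<exists>grad. (\<forall>x. GDERIV f x :> grad x) \<and>
             (\<forall>x y. norm (grad x - grad y) \<le> M * norm (x - y)))"

definition subdifferential :: "('a::real_inner \<Rightarrow> real) \<Rightarrow> 'a \<Rightarrow> 'a set" where
  "subdifferential f x = {g. \<forall>z. f z \<ge> f x + g \<bullet> (z - x)}"

definition mat_range :: "real^'n^'m \<Rightarrow> (real^'m) set" where
  "mat_range B = range (\<lambda>z. B *v z)"

definition mat_null :: "real^'n^'m \<Rightarrow> (real^'n) set" where
  "mat_null B = {z. B *v z = 0}"

text \<open>
  The two conditions on \<open>N\<close> say that \<open>N\<close> enumerates, without repetition, the blocks of a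
  partition of the set of terminals (blocks of a \<^const>\<open>partition_on\<close> are nonempty).
\<close>

definition selection_matrix :: "real^'m^'n \<Rightarrow> bool" where
  "selection_matrix E \<longleftrightarrow>
     (\<exists>N :: 'n \<Rightarrow> 'm set. partition_on UNIV (range N) \<and> inj N \<and>
        E = (\<chi> i j. if j \<in> N i then 1 else 0))"

datatype component_kind = Resistor | Inductor | Capacitor

text \<open>
  An RLC circuit.  The nodes are the elements of the finite type \<open>'v\<close>; \<open>terminal_node\<close> sends the
  terminals, i.e. the coordinates of \<open>real^'m\<close>, to the nodes they are connected to.  The components
  form a finite, possibly empty set, so vectors indexed by components are functions of
  type \<open>'c \<Rightarrow> real\<close> of which only the values on \<open>comps\<close> matter.  The field \<open>param\<close> is the
  resistance, inductance or capacitance, i.e. the diagonal entry of the matrix belonging to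
  the kind of the component.
\<close>

record ('m, 'v, 'c) circuit =
  comps :: "'c set"
  kind :: "'c \<Rightarrow> component_kind"
  param :: "'c \<Rightarrow> real"
  plus_node :: "'c \<Rightarrow> 'v"
  minus_node :: "'c \<Rightarrow> 'v"
  terminal_node :: "'m \<Rightarrow> 'v"
  ground :: "'v"

definition ideal_wires :: "('m, 'v, 'c) circuit \<Rightarrow> 'c set" where
  "ideal_wires D = {j \<in> comps D. kind D j = Resistor \<and> param D j = 0}"

text \<open>
  A loop of ideal wires is an undirected cycle: wire \<open>js ! k\<close> joins node \<open>ns ! k\<close> to its
  cyclic successor.  Length one is a wire with both ends on the same node,
  length two a pair of parallel wires.
\<close>

definition wire_loop :: "('m, 'v, 'c) circuit \<Rightarrow> 'v list \<Rightarrow> 'c list \<Rightarrow> bool" where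
  "wire_loop D ns js \<longleftrightarrow>
     js \<noteq> [] \<and> length ns = length js \<and> distinct ns \<and> distinct js \<and> set js \<subseteq> ideal_wires D \<and>
     (\<forall>k < length js. {plus_node D (js ! k), minus_node D (js ! k)}
                      = {ns ! k, ns ! (Suc k mod length ns)})"

text \<open>
  Since the ground is not a terminal node and distinct terminals are connected to distinct nodes,
  there is at least one node more than there are terminals.
\<close>

definition dynamic_interconnect :: "('m::finite, 'v::finite, 'c) circuit \<Rightarrow> bool" where
  "dynamic_interconnect D \<longleftrightarrow>
     finite (comps D) \<and>
     inj (terminal_node D) \<and> ground D \<notin> range (terminal_node D) \<and>
     (\<forall>j \<in> comps D. case kind D j of
          Resistor \<Rightarrow> param D j \<ge> 0
        | Inductor \<Rightarrow> param D j > 0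
        | Capacitor \<Rightarrow> param D j > 0) \<and>
     (\<nexists>ns js. wire_loop D ns js)"

text \<open>
  Entry of the node incidence matrix: \<open>1\<close> at the plus node, \<open>-1\<close> at the minus node, \<open>0\<close> elsewhere.
  A component with both terminals on the same node gets a zero column.
  The reduced matrix is obtained by only using rows \<open>r \<noteq> ground D\<close>.
\<close>

definition incidence :: "('m, 'v, 'c) circuit \<Rightarrow> 'v \<Rightarrow> 'c \<Rightarrow> real" where
  "incidence D r j = of_bool (r = plus_node D j) - of_bool (r = minus_node D j)"

text \<open>
  The block vector with \<open>x\<close> on the terminal nodes and \<open>e\<close> on the remaining nodes.  It is only used
  on nodes other than the ground, so only the values of \<open>e\<close> on the nodes that
  are neither terminal nor ground matter.
\<close>

definition stack :: "('m::finite, 'v, 'c) circuit \<Rightarrow> real^'m \<Rightarrow> ('v \<Rightarrow> real) \<Rightarrow> 'v \<Rightarrow> real" where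
  "stack D x e r =
     (if r \<in> range (terminal_node D) then x $ inv (terminal_node D) r else e r)"

text \<open>Kirchhoff's current law, \<open>A i = (-y, 0)\<close>.\<close>

definition kcl :: "('m::finite, 'v, 'c) circuit \<Rightarrow> ('c \<Rightarrow> real) \<Rightarrow> real^'m \<Rightarrow> bool" where
  "kcl D i y \<longleftrightarrow>
     (\<forall>r. r \<noteq> ground D \<longrightarrow>
        (\<Sum>j \<in> comps D. incidence D r j * i j) = stack D (- y) (\<lambda>_. 0) r)"

text \<open>Kirchhoff's voltage law, \<open>v = A\<^sup>T (x, e)\<close>.\<close>

definition kvl ::
  "('m::finite, 'v::finite, 'c) circuit \<Rightarrow> ('c \<Rightarrow> real) \<Rightarrow> real^'m \<Rightarrow> ('v \<Rightarrow> real) \<Rightarrow> bool" where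
  "kvl D v x e \<longleftrightarrow>
     (\<forall>j \<in> comps D. v j = (\<Sum>r \<in> UNIV - {ground D}. incidence D r j * stack D x e r))"

definition static_behaviour :: "('m::finite, 'v::finite, 'c) circuit \<Rightarrow> ((real^'m) \<times> (real^'m)) set" where
  "static_behaviour D = {(x, y). \<exists>v i e. kcl D i y \<and> kvl D v x e \<and>
     (\<forall>j \<in> comps D. case kind D j of
          Resistor \<Rightarrow> v j = param D j * i j
        | Inductor \<Rightarrow> v j = 0
        | Capacitor \<Rightarrow> i j = 0)}"

definition admissible :: "('m::finite, 'v::finite, 'c) circuit \<Rightarrow> real^'m^'n \<Rightarrow> bool" where
  "admissible D E \<longleftrightarrow> static_behaviour D = mat_range (transpose E) \<times> mat_null E"

definition component_dynamics ::
  "('m, 'v, 'c) circuit \<Rightarrow> (real \<Rightarrow> 'c \<Rightarrow> real) \<Rightarrow> (real \<Rightarrow> 'c \<Rightarrow> real) \<Rightarrow> real \<Rightarrow> bool" where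
  "component_dynamics D v i t \<longleftrightarrow>
     (\<forall>j \<in> comps D. case kind D j of
          Resistor \<Rightarrow> v t j = param D j * i t j
        | Inductor \<Rightarrow>
            (\<exists>d. ((\<lambda>s. i s j) has_real_derivative d) (at t) \<and> v t j = param D j * d)
        | Capacitor \<Rightarrow>
            (\<exists>d. ((\<lambda>s. v s j) has_real_derivative d) (at t) \<and> i t j = param D j * d))"

text \<open>
  The curves are given as functions on the whole real line,
  but only their values at positive times are constrained.
\<close>

definition interconnect_curve ::
  "(real^'m \<Rightarrow> real) \<Rightarrow> ('m::finite, 'v::finite, 'c) circuit \<Rightarrow> (real \<Rightarrow> 'c \<Rightarrow> real) \<Rightarrow>
   (real \<Rightarrow> 'c \<Rightarrow> real) \<Rightarrow> (real \<Rightarrow> real^'m) \<Rightarrow> (real \<Rightarrow> real^'m) \<Rightarrow> bool" where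
  "interconnect_curve f D v i x y \<longleftrightarrow>
     (\<forall>t > 0. y t \<in> subdifferential f (x t) \<and> kcl D (i t) (y t) \<and>
              (\<exists>e. kvl D (v t) (x t) e) \<and> component_dynamics D v i t)"

definition primal_dual_pair ::
  "(real^'m \<Rightarrow> real) \<Rightarrow> real^'m^'n \<Rightarrow> real^'m \<Rightarrow> real^'m \<Rightarrow> bool" where
  "primal_dual_pair f E xs ys \<longleftrightarrow>
     ys \<in> subdifferential f xs \<and> xs \<in> mat_range (transpose E) \<and> ys \<in> mat_null E"

end

theory Submission
  imports Defs
begin

text \<open>
  Let \<open>z\<close> collect the inductor currents and capacitor voltages.  By Tellegen's theorem and strong
  monotonicity of \<open>\<partial>f\<close>, for any two solutions the energy \<open>(1/2) \<Sum> w\<^sub>j (z\<^sub>j - z'\<^sub>j)\<^sup>2\<close> of the difference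
  decays at rate at least \<open>\<mu> \<parallel>x - x'\<parallel>\<^sup>2\<close>.  By admissibility the primal-dual pair extends to a constant
  solution, so \<open>\<parallel>x - x\<^sup>\<star>\<parallel>\<^sup>2\<close> is integrable.  Comparing a curve with its own time shift shows that the
  speed \<open>\<Sum> w\<^sub>j (dz\<^sub>j/dt)\<^sup>2\<close> is nonincreasing, hence \<open>z\<close> is Lipschitz; the dissipation inequality then makes
  \<open>x\<close> Hoelder continuous with exponent \<open>1/2\<close> (although \<open>x\<close> need not be differentiable), and
  Barbalat's argument gives \<open>x \<longlonglongrightarrow> x\<^sup>\<star>\<close>.  Finally \<open>y = \<nabla>f x\<close> with \<open>\<nabla>f\<close> Lipschitz.
\<close>

section \<open>Subgradients of strongly convex and of smooth functions\<close>

text \<open>On the segment from \<open>x\<close> to \<open>z\<close>, convexity of \<open>f\<close>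
  minus the quadratic bounds \<open>f\<close> from above and the subgradient bounds it from below.
  Cancelling the common factor \<open>l\<close> leaves the claim with \<open>\<mu> * (1 - l)\<close>
  in place of \<open>\<mu>\<close>; then \<open>l\<close> tends to 0.\<close>

lemma strongly_convex_subgradient_bound:
  fixes f :: "'a::real_inner \<Rightarrow> real"
  assumes sc: "strongly_convex \<mu> f" and g: "g \<in> subdifferential f x"
  shows "f x + g \<bullet> (z - x) + \<mu> / 2 * (norm (z - x))\<^sup>2 \<le> f z"
proof -
  define q where "q = (norm (z - x))\<^sup>2"
  have *: "g \<bullet> (z - x) + \<mu> / 2 * (1 - l) * q \<le> f z - f x" if l: "0 < l" "l \<le> 1" for l :: real
  proof -
    let ?u = "x + l *\<^sub>R (z - x)"
    have u: "?u = (1 - l) *\<^sub>R x + l *\<^sub>R z" by (simp add: algebra_simps)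
    have conv: "f ?u - \<mu> / 2 * (norm ?u)\<^sup>2
        \<le> (1 - l) * (f x - \<mu> / 2 * (norm x)\<^sup>2) + l * (f z - \<mu> / 2 * (norm z)\<^sup>2)"
      using convex_onD[OF sc[unfolded strongly_convex_def], of l x z] l unfolding u by simp
    have norm_u: "(norm ?u)\<^sup>2 = (1 - l) * (norm x)\<^sup>2 + l * (norm z)\<^sup>2 - l * (1 - l) * q"
      unfolding u q_def power2_norm_eq_inner
      by (simp add: inner_add_left inner_add_right inner_diff_left inner_diff_right inner_commute
          algebra_simps)
    have "f ?u \<le> (1 - l) * f x + l * f z - \<mu> / 2 * (l * (1 - l) * q)"
      using conv unfolding norm_u by (simp add: algebra_simps add_divide_distrib diff_divide_distrib)
    moreover have "f x + g \<bullet> (?u - x) \<le> f ?u"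
      using g unfolding subdifferential_def by blast
    ultimately have "l * (g \<bullet> (z - x) + \<mu> / 2 * (1 - l) * q) \<le> l * (f z - f x)"
      by (simp add: algebra_simps add_divide_distrib diff_divide_distrib)
    then show ?thesis using l by simp
  qed
  have "((\<lambda>l. g \<bullet> (z - x) + \<mu> / 2 * (1 - l) * q) \<longlongrightarrow> g \<bullet> (z - x) + \<mu> / 2 * (1 - 0) * q) (at_right 0)"
    by (intro tendsto_intros)
  moreover have "\<forall>\<^sub>F l in at_right 0. g \<bullet> (z - x) + \<mu> / 2 * (1 - l) * q \<le> f z - f x"
    unfolding eventually_at_right_field using * by (intro exI[of _ 1]) auto
  ultimately have "g \<bullet> (z - x) + \<mu> / 2 * (1 - 0) * q \<le> f z - f x"
    by (intro tendsto_upperbound) auto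
  then show ?thesis by (simp add: q_def)
qed

text \<open>Adding the quadratic lower bounds at \<open>x\<close> and at \<open>x'\<close> cancels
  the function values.\<close>

lemma strongly_convex_imp_strongly_monotone:
  fixes f :: "'a::real_inner \<Rightarrow> real"
  assumes "strongly_convex \<mu> f" "g \<in> subdifferential f x" "g' \<in> subdifferential f x'"
  shows "\<mu> * (norm (x - x'))\<^sup>2 \<le> (x - x') \<bullet> (g - g')"
proof -
  have "f x + g \<bullet> (x' - x) + \<mu> / 2 * (norm (x' - x))\<^sup>2 \<le> f x'"
    "f x' + g' \<bullet> (x - x') + \<mu> / 2 * (norm (x - x'))\<^sup>2 \<le> f x"
    using strongly_convex_subgradient_bound[OF assms(1)] assms(2,3) by auto
  then show ?thesis
    by (simp add: norm_minus_commute[of x' x] inner_diff_left inner_diff_right inner_commute)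
qed

text \<open>A subgradient \<open>y\<close> makes \<open>x\<close> a minimizer of
  \<open>f z - y \<bullet> z\<close>, so the derivative of that function vanishes there.\<close>

lemma subdifferential_GDERIV:
  assumes "GDERIV f x :> g" "y \<in> subdifferential f x"
  shows "y = g"
proof -
  have "((\<lambda>z. f z - y \<bullet> z) has_derivative (\<lambda>h. h \<bullet> g - y \<bullet> h)) (at x)"
    using assms(1) unfolding gderiv_def by (auto intro!: derivative_eq_intros)
  moreover have "\<forall>\<^sub>F z in at x. f x - y \<bullet> x \<le> f z - y \<bullet> z"
    using assms(2) by (intro always_eventually)
      (auto simp: subdifferential_def inner_diff_right algebra_simps)
  ultimately have "(\<lambda>h. h \<bullet> g - y \<bullet> h) = (\<lambda>h. 0)"
    by (rule has_derivative_local_min)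
  \<comment> \<open>The vanishing derivative is evaluated in the direction
    \<open>g - y\<close>.\<close>
  then have "(g - y) \<bullet> g - y \<bullet> (g - y) = 0" by metis
  then have "(g - y) \<bullet> (g - y) = 0"
    by (simp add: inner_diff_left inner_diff_right inner_commute)
  then show ?thesis by simp
qed

lemma smooth_subgradient_Lipschitz:
  assumes "smooth_with M f" "y \<in> subdifferential f x" "y' \<in> subdifferential f x'"
  shows "norm (y - y') \<le> M * norm (x - x')"
  using assms unfolding smooth_with_def by (metis subdifferential_GDERIV)

section \<open>Kirchhoff's laws and the power balance\<close>

lemma kcl_diff:
  assumes "kcl D i y" "kcl D i' y'"
  shows "kcl D (\<lambda>j. i j - i' j) (y - y')"
  using assms by (auto simp: kcl_def stack_def right_diff_distrib sum_subtractf)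

lemma kvl_diff:
  assumes "kvl D v x e" "kvl D v' x' e'"
  shows "kvl D (\<lambda>j. v j - v' j) (x - x') (\<lambda>r. e r - e' r)"
proof -
  have "stack D (x - x') (\<lambda>r. e r - e' r) r = stack D x e r - stack D x' e' r" for r
    by (simp add: stack_def)
  with assms show ?thesis by (simp add: kvl_def right_diff_distrib sum_subtractf)
qed

text \<open>Inserting the voltage law and swapping the sums turns the power into potentials times
  net node currents. By the current law these currents vanish off the terminals, so the inner
  potentials \<open>e\<close> drop out.\<close>

lemma tellegen:
  fixes D :: "('m::finite, 'v::finite, 'c) circuit"
  assumes "inj (terminal_node D)" "ground D \<notin> range (terminal_node D)"
    and "kcl D i y" "kvl D v x e"
  shows "(\<Sum>j\<in>comps D. v j * i j) = - (x \<bullet> y)"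
proof -
  let ?R = "UNIV - {ground D}"
  have "(\<Sum>j\<in>comps D. v j * i j)
      = (\<Sum>j\<in>comps D. \<Sum>r\<in>?R. stack D x e r * (incidence D r j * i j))"
    using assms(4) by (intro sum.cong) (auto simp: kvl_def sum_distrib_left sum_distrib_right mult_ac)
  also have "\<dots> = (\<Sum>r\<in>?R. stack D x e r * (\<Sum>j\<in>comps D. incidence D r j * i j))"
    by (subst sum.swap) (simp add: sum_distrib_left)
  also have "\<dots> = (\<Sum>r\<in>?R. stack D x e r * stack D (- y) (\<lambda>_. 0) r)"
    using assms(3) by (intro sum.cong) (auto simp: kcl_def)
  also have "\<dots> = (\<Sum>r\<in>range (terminal_node D). stack D x e r * stack D (- y) (\<lambda>_. 0) r)"
    using assms(2) by (intro sum.mono_neutral_right ballI subset_Diff_insert[THEN iffD2] conjI)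
      (simp_all add: stack_def)
  also have "\<dots> = (\<Sum>k\<in>UNIV. x $ k * - y $ k)"
    using assms(1) by (subst sum.reindex) (auto simp: stack_def)
  also have "\<dots> = - (x \<bullet> y)"
    by (simp add: inner_vec_def sum_negf)
  finally show ?thesis .
qed

text \<open>Kirchhoff's laws are linear, so Tellegen applies to the difference of two states, and
  strong monotonicity bounds the total power. Resistors absorb nonnegative power, so dropping them
  preserves the upper bound. Asking only for the resistor laws lets the lemma compare two times of a
  curve as well as a curve with the equilibrium.\<close>

lemma storage_power_bound:
  fixes D :: "('m::finite, 'v::finite, 'c) circuit" and f :: "real^'m \<Rightarrow> real"
  defines "J \<equiv> {j \<in> comps D. kind D j \<noteq> Resistor}"
  assumes sc: "strongly_convex \<mu> f" and D: "dynamic_interconnect D"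
    and y: "y \<in> subdifferential f x" "kcl D i y" "kvl D v x e"
    and y': "y' \<in> subdifferential f x'" "kcl D i' y'" "kvl D v' x' e'"
    and res: "\<And>j. j \<in> comps D \<Longrightarrow> kind D j = Resistor \<Longrightarrow> v j = param D j * i j"
      "\<And>j. j \<in> comps D \<Longrightarrow> kind D j = Resistor \<Longrightarrow> v' j = param D j * i' j"
  shows "(\<Sum>j\<in>J. (v j - v' j) * (i j - i' j)) \<le> - \<mu> * (norm (x - x'))\<^sup>2"
proof -
  let ?p = "\<lambda>j. (v j - v' j) * (i j - i' j)"
  have fin: "finite (comps D)" using D by (simp add: dynamic_interconnect_def)
  have "0 \<le> ?p j" if j: "j \<in> comps D - J" for j
  proof -
    have k: "j \<in> comps D" "kind D j = Resistor" using j by (auto simp: J_def)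
    then have "?p j = param D j * (i j - i' j)\<^sup>2"
      using res by (simp add: power2_eq_square algebra_simps)
    moreover have "0 \<le> param D j"
      using D k by (force simp: dynamic_interconnect_def)
    ultimately show ?thesis by simp
  qed
  then have "sum ?p J \<le> sum ?p (comps D)"
    using fin by (intro sum_mono2) (auto simp: J_def)
  also have "\<dots> = - ((x - x') \<bullet> (y - y'))"
    using D kcl_diff[OF y(2) y'(2)] kvl_diff[OF y(3) y'(3)]
    by (intro tellegen) (auto simp: dynamic_interconnect_def)
  also have "\<dots> \<le> - \<mu> * (norm (x - x'))\<^sup>2"
    using strongly_convex_imp_strongly_monotone[OF sc y(1) y'(1)] by simp
  finally show ?thesis .
qed

section \<open>Convergence of abstract dissipative systems\<close>

text \<open>The weighted squared distance between \<open>z\<close> and its shift by \<open>h\<close>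
  is nonincreasing in time. Divided by \<open>h\<^sup>2\<close>, it tends to the squared speed as
  \<open>h\<close> tends to 0. No derivative of \<open>d\<close> is taken.\<close>

lemma dissipative_speed_antimono:
  fixes z d :: "real \<Rightarrow> 'c \<Rightarrow> real"
  assumes deriv: "\<And>t j. t > 0 \<Longrightarrow> j \<in> J \<Longrightarrow> ((\<lambda>s. z s j) has_real_derivative d t j) (at t)"
    and diss: "\<And>s t. s > 0 \<Longrightarrow> t > 0 \<Longrightarrow> (\<Sum>j\<in>J. w j * (d s j - d t j) * (z s j - z t j)) \<le> 0"
    and st: "0 < s" "s \<le> t"
  shows "(\<Sum>j\<in>J. w j * (d t j)\<^sup>2) \<le> (\<Sum>j\<in>J. w j * (d s j)\<^sup>2)"
proof -
  define G where "G h r = (\<Sum>j\<in>J. w j * (z (r + h) j - z r j)\<^sup>2)" for h r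
  have G_le: "G h t \<le> G h s" if h: "h > 0" for h
  proof (rule DERIV_nonpos_imp_nonincreasing[OF st(2)])
    fix r assume r: "s \<le> r" "r \<le> t"
    have "((\<lambda>r. z (r + h) j) has_real_derivative d (r + h) j) (at r)" if "j \<in> J" for j
      using deriv[of "r + h" j] that r st h by (simp add: DERIV_shift)
    then have "(G h has_real_derivative
        (\<Sum>j\<in>J. w j * (2 * (z (r + h) j - z r j) * (d (r + h) j - d r j)))) (at r)"
      unfolding G_def using deriv[of r] r st
      by (auto intro!: derivative_eq_intros sum.cong)
    moreover have "(\<Sum>j\<in>J. w j * (2 * (z (r + h) j - z r j) * (d (r + h) j - d r j)))
        = 2 * (\<Sum>j\<in>J. w j * (d (r + h) j - d r j) * (z (r + h) j - z r j))"
      by (simp add: sum_distrib_left algebra_simps)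
    ultimately show "\<exists>y. (G h has_real_derivative y) (at r) \<and> y \<le> 0"
      using diss[of "r + h" r] r st h by (auto intro!: exI)
  qed
  have lim: "((\<lambda>h. G h r / h\<^sup>2) \<longlongrightarrow> (\<Sum>j\<in>J. w j * (d r j)\<^sup>2)) (at_right 0)" if r: "r > 0" for r
  proof -
    have "((\<lambda>h. \<Sum>j\<in>J. w j * ((z (r + h) j - z r j) / h)\<^sup>2) \<longlongrightarrow> (\<Sum>j\<in>J. w j * (d r j)\<^sup>2)) (at_right 0)"
      using deriv[OF r] unfolding DERIV_def
      by (intro tendsto_intros tendsto_within_subset[of _ _ 0 UNIV "{0<..}"]) simp_all
    then show ?thesis
      by (simp add: G_def sum_divide_distrib power_divide)
  qed
  show ?thesis
  proof (rule tendsto_le[OF _ lim lim])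
    show "\<forall>\<^sub>F h in at_right 0. G h t / h\<^sup>2 \<le> G h s / h\<^sup>2"
      using eventually_at_right_less[of "0::real"] by eventually_elim (simp add: G_le divide_right_mono)
  qed (use st in auto)
qed

lemma dissipative_convergence:
  fixes z d :: "real \<Rightarrow> 'c \<Rightarrow> real" and x :: "real \<Rightarrow> 'a::real_normed_vector"
  assumes J: "finite J" and w: "\<And>j. j \<in> J \<Longrightarrow> w j > 0" and mu: "\<mu> > 0"
    and deriv: "\<And>t j. t > 0 \<Longrightarrow> j \<in> J \<Longrightarrow> ((\<lambda>s. z s j) has_real_derivative d t j) (at t)"
    and diss: "\<And>s t. s > 0 \<Longrightarrow> t > 0 \<Longrightarrow>
      (\<Sum>j\<in>J. w j * (d s j - d t j) * (z s j - z t j)) \<le> - \<mu> * (norm (x s - x t))\<^sup>2"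
    and diss_eq: "\<And>t. t > 0 \<Longrightarrow>
      (\<Sum>j\<in>J. w j * d t j * (z t j - zs j)) \<le> - \<mu> * (norm (x t - xs))\<^sup>2"
  shows "(x \<longlongrightarrow> xs) at_top"
proof -
  \<comment> \<open>The speed at time 1 bounds all later speeds. Starting at a positive time keeps
    to the region where derivatives are available. \<open>B j\<close> solves
    \<open>w j * (B j)\<^sup>2 = S\<close>.\<close>
  define S where "S = (\<Sum>j\<in>J. w j * (d 1 j)\<^sup>2)"
  define B where "B j = sqrt (S / w j)" for j
  have S0: "S \<ge> 0" unfolding S_def using w by (intro sum_nonneg) (simp add: less_imp_le)
  have d_le: "\<bar>d t j\<bar> \<le> B j" if t: "t \<ge> 1" and j: "j \<in> J" for t j
  proof -
    have "w j * (d t j)\<^sup>2 \<le> (\<Sum>j\<in>J. w j * (d t j)\<^sup>2)"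
      using J j w by (intro member_le_sum) (auto simp: less_imp_le)
    also have "\<dots> \<le> S"
      unfolding S_def
    proof (rule dissipative_speed_antimono[OF deriv])
      show "(\<Sum>j\<in>J. w j * (d s j - d t j) * (z s j - z t j)) \<le> 0" if "s > 0" "t > 0" for s t
      proof -
        have "- \<mu> * (norm (x s - x t))\<^sup>2 \<le> 0" using mu by simp
        with diss[OF that] show ?thesis by linarith
      qed
    qed (use t in auto)
    finally have "(d t j)\<^sup>2 \<le> S / w j" using w[OF j] by (simp add: field_simps)
    then show ?thesis unfolding B_def by (metis real_le_rsqrt power2_abs)
  qed
  have z_Lip: "\<bar>z s j - z t j\<bar> \<le> B j * \<bar>s - t\<bar>" if "s \<ge> 1" "t \<ge> 1" "j \<in> J" for s t j
  proof -
    have "norm (z s j - z t j) \<le> B j * norm (s - t)"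
    proof (rule field_differentiable_bound[of "{1..}" "\<lambda>s. z s j" "\<lambda>s. d s j"])
      show "((\<lambda>s. z s j) has_real_derivative d r j) (at r within {1..})" if "r \<in> {1..}" for r
        using that \<open>j \<in> J\<close> by (auto intro!: has_field_derivative_at_within[OF deriv])
    qed (use that d_le in auto)
    then show ?thesis by simp
  qed
  \<comment> \<open>Each of the \<open>card J\<close> summands of the dissipation inequality is at
    most \<open>w j * (2 * B j) * (B j * \<bar>s - t\<bar>)\<close>, which is
    \<open>2 * S * \<bar>s - t\<bar>\<close>; dividing the total by \<open>\<mu>\<close> gives
    \<open>K\<close>.\<close>
  define K where "K = 2 * card J * S / \<mu>"
  have x_Hoelder: "(norm (x s - x t))\<^sup>2 \<le> K * \<bar>s - t\<bar>" if st: "s \<ge> 1" "t \<ge> 1" for s t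
  proof -
    have "\<mu> * (norm (x s - x t))\<^sup>2 \<le> (\<Sum>j\<in>J. - (w j * (d s j - d t j) * (z s j - z t j)))"
      using diss[of s t] st by (simp add: sum_negf)
    also have "\<dots> \<le> (\<Sum>j\<in>J. 2 * S * \<bar>s - t\<bar>)"
    proof (rule sum_mono)
      fix j assume j: "j \<in> J"
      have "\<bar>d s j - d t j\<bar> * \<bar>z s j - z t j\<bar> \<le> (2 * B j) * (B j * \<bar>s - t\<bar>)"
        using d_le[of s j] d_le[of t j] z_Lip[of s t j] st j by (intro mult_mono) auto
      also have "\<dots> = 2 * (B j)\<^sup>2 * \<bar>s - t\<bar>"
        by (simp add: power2_eq_square)
      also have "(B j)\<^sup>2 = S / w j"
        using S0 w[OF j] by (simp add: B_def)
      finally have "w j * (\<bar>d s j - d t j\<bar> * \<bar>z s j - z t j\<bar>) \<le> 2 * S * \<bar>s - t\<bar>"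
        using w[OF j] by (simp add: pos_le_divide_eq mult.commute)
      then have "\<bar>w j * (d s j - d t j) * (z s j - z t j)\<bar> \<le> 2 * S * \<bar>s - t\<bar>"
        using w[OF j] by (simp add: abs_mult mult.assoc)
      then show "- (w j * (d s j - d t j) * (z s j - z t j)) \<le> 2 * S * \<bar>s - t\<bar>" by linarith
    qed
    finally show ?thesis using mu by (simp add: K_def field_simps)
  qed
  have K0: "K \<ge> 0" using S0 mu by (simp add: K_def)
  \<comment> \<open>The stored energy relative to the equilibrium serves as Lyapunov function;
    \<open>V'\<close> is its derivative.\<close>
  define V where "V t = (\<Sum>j\<in>J. w j * (z t j - zs j)\<^sup>2) / 2" for t
  define V' where "V' t = (\<Sum>j\<in>J. w j * d t j * (z t j - zs j))" for t
  have V_deriv: "(V has_real_derivative V' t) (at t)" if t: "t > 0" for t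
    unfolding V_def V'_def using deriv[OF t]
    by (auto intro!: derivative_eq_intros sum.cong simp: sum_divide_distrib)
  have V'_le: "V' t \<le> - \<mu> * (norm (x t - xs))\<^sup>2" if "t > 0" for t
    using diss_eq[OF that] by (simp add: V'_def)
  have V'_nonpos: "V' t \<le> 0" if "t > 0" for t
  proof -
    have "- \<mu> * (norm (x t - xs))\<^sup>2 \<le> 0" using mu by simp
    with V'_le[OF that] show ?thesis by linarith
  qed
  have V_dec: "V t \<le> V s" if "s > 0" "s \<le> t" for s t
  proof (rule DERIV_nonpos_imp_nonincreasing[OF that(2)])
    fix r assume "s \<le> r"
    then have "r > 0" using that(1) by simp
    then show "\<exists>y. (V has_real_derivative y) (at r) \<and> y \<le> 0"
      using V_deriv V'_nonpos by blast
  qed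
  have V0: "0 \<le> V t" for t
    unfolding V_def using w by (auto intro!: sum_nonneg simp: less_imp_le)
  show ?thesis
  proof (rule tendstoI)
    fix \<epsilon> :: real assume eps: "\<epsilon> > 0"
    \<comment> \<open>Over a time \<open>\<delta>\<close>, \<open>x\<close> moves by less than
      \<open>\<epsilon> / 2\<close>. The denominator \<open>K + 1\<close> also covers
      \<open>K = 0\<close>.\<close>
    define \<delta> where "\<delta> = (\<epsilon> / 2)\<^sup>2 / (K + 1)"
    have delta: "\<delta> > 0" "K * \<delta> < (\<epsilon> / 2)\<^sup>2"
      using eps K0 by (auto simp: \<delta>_def field_simps)
    \<comment> \<open>The least energy lost in time \<open>\<delta>\<close> if \<open>x\<close>
      stays at distance at least \<open>\<epsilon> / 2\<close> from \<open>xs\<close>.\<close>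
    define \<eta> where "\<eta> = \<delta> * (\<mu> * (\<epsilon> / 2)\<^sup>2)"
    have "\<eta> > 0" using delta mu eps by (simp add: \<eta>_def)
    have bdd: "bdd_below (V ` {1..})" using V0 by (rule bdd_belowI2)
    \<comment> \<open>Past \<open>T\<close> the nonincreasing \<open>V\<close> lies within
      \<open>\<eta>\<close> of its infimum, so it can no longer lose \<open>\<eta>\<close>.\<close>
    have "Inf (V ` {1..}) < Inf (V ` {1..}) + \<eta>" using \<open>\<eta> > 0\<close> by simp
    then obtain T where T: "T \<ge> 1" "V T < Inf (V ` {1..}) + \<eta>"
      using cInf_lessD[of "V ` {1..}" "Inf (V ` {1..}) + \<eta>"] by auto
    have "dist (x t) xs < \<epsilon>" if t: "t \<ge> T" for t
    proof -
      \<comment> \<open>The mean value theorem yields a time \<open>\<xi>\<close> within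
        \<open>\<delta>\<close> of \<open>t\<close> at which the energy loss is slow, hence
        \<open>x \<xi>\<close> is close to \<open>xs\<close>; Hoelder continuity carries this back
        to \<open>t\<close>.\<close>
      have "\<exists>\<xi>. t < \<xi> \<and> \<xi> < t + \<delta> \<and> V (t + \<delta>) - V t = (t + \<delta> - t) * V' \<xi>"
        using t T delta by (intro MVT2 V_deriv) auto
      then obtain \<xi> where xi: "t < \<xi>" "\<xi> < t + \<delta>" "V (t + \<delta>) - V t = \<delta> * V' \<xi>" by auto
      have "Inf (V ` {1..}) \<le> V (t + \<delta>)"
        using bdd t T delta by (intro cInf_lower) auto
      moreover have "V t \<le> V T" using t T by (intro V_dec) auto
      ultimately have "\<delta> * (- V' \<xi>) < \<eta>" using xi T by simp
      then have "- V' \<xi> < \<mu> * (\<epsilon> / 2)\<^sup>2"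
        unfolding \<eta>_def mult_less_cancel_left_pos[OF delta(1)] .
      moreover have "\<mu> * (norm (x \<xi> - xs))\<^sup>2 \<le> - V' \<xi>"
        using V'_le[of \<xi>] xi(1) t T(1) by linarith
      ultimately have "\<mu> * (norm (x \<xi> - xs))\<^sup>2 < \<mu> * (\<epsilon> / 2)\<^sup>2" by linarith
      then have "(norm (x \<xi> - xs))\<^sup>2 < (\<epsilon> / 2)\<^sup>2" using mu by simp
      then have 1: "norm (x \<xi> - xs) < \<epsilon> / 2"
        by (rule power2_less_imp_less) (use eps in simp)
      have "(norm (x t - x \<xi>))\<^sup>2 \<le> K * \<bar>t - \<xi>\<bar>" using xi t T by (intro x_Hoelder) auto
      also have "\<dots> \<le> K * \<delta>" using K0 xi by (intro mult_left_mono) auto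
      also note delta(2)
      finally have 2: "norm (x t - x \<xi>) < \<epsilon> / 2"
        by (rule power2_less_imp_less) (use eps in simp)
      show ?thesis
        using 1 2 norm_triangle_ineq[of "x t - x \<xi>" "x \<xi> - xs"] by (simp add: dist_norm)
    qed
    then show "\<forall>\<^sub>F t in at_top. dist (x t) xs < \<epsilon>"
      unfolding eventually_at_top_linorder by (intro exI[of _ T]) simp
  qed
qed

section \<open>Application to the interconnect\<close>

theorem theorem2p2:
  fixes f :: "real^'m \<Rightarrow> real"
    and \<mu> M :: real
    and E :: "real^'m^'n"
    and D :: "('m, 'v::finite, 'c) circuit"
    and xs ys :: "real^'m"
    and v i :: "real \<Rightarrow> 'c \<Rightarrow> real"
    and x y :: "real \<Rightarrow> real^'m"
  assumes "\<mu> > 0" and "M > 0"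
    and "strongly_convex \<mu> f" and "smooth_with M f"
    and "selection_matrix E"
    and "dynamic_interconnect D"
    and "admissible D E"
    and "primal_dual_pair f E xs ys"
    and "interconnect_curve f D v i x y"
  shows "((\<lambda>t. (x t, y t)) \<longlongrightarrow> (xs, ys)) at_top"
proof -
  \<comment> \<open>Admissibility supplies equilibrium voltages and currents for the primal-dual
    pair.\<close>
  have ys: "ys \<in> subdifferential f xs" and "(xs, ys) \<in> static_behaviour D"
    using assms(7,8) by (auto simp: primal_dual_pair_def admissible_def)
  then obtain vs "is" es where kcls: "kcl D is ys" and kvls: "kvl D vs xs es"
    and static: "\<And>j. j \<in> comps D \<Longrightarrow> case kind D j of
          Resistor \<Rightarrow> vs j = param D j * is j
        | Inductor \<Rightarrow> vs j = 0
        | Capacitor \<Rightarrow> is j = 0"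
    unfolding static_behaviour_def by auto
  have y: "y t \<in> subdifferential f (x t)" and kcl: "kcl D (i t) (y t)"
    and kvl: "\<exists>e. kvl D (v t) (x t) e" and dyn: "component_dynamics D v i t" if "t > 0" for t
    using assms(9) that by (auto simp: interconnect_curve_def)
  have res: "v t j = param D j * i t j" if "t > 0" "j \<in> comps D" "kind D j = Resistor" for t j
    using dyn[OF that(1)] that by (auto simp: component_dynamics_def)
  have ress: "vs j = param D j * is j" if "j \<in> comps D" "kind D j = Resistor" for j
    using static[OF that(1)] that by simp

  define J where "J = {j \<in> comps D. kind D j \<noteq> Resistor}"
  \<comment> \<open>\<open>z\<close> is the state and \<open>d\<close> its derivative, read off from
    the component laws. On \<open>J\<close> the \<open>else\<close> branches concern capacitors
    only.\<close>
  define z where "z t j = (if kind D j = Inductor then i t j else v t j)" for t j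
  define d where "d t j = (if kind D j = Inductor then v t j else i t j) / param D j" for t j
  define zs where "zs j = (if kind D j = Inductor then is j else vs j)" for j
  have param: "param D j > 0" if "j \<in> J" for j
    using assms(6) that by (cases "kind D j") (force simp: dynamic_interconnect_def J_def)+
  have "(x \<longlongrightarrow> xs) at_top"
  proof (rule dissipative_convergence[where J = J and w = "param D" and z = z and d = d and zs = zs])
    show "finite J" using assms(6) by (simp add: J_def dynamic_interconnect_def)
    show "((\<lambda>s. z s j) has_real_derivative d t j) (at t)" if "t > 0" "j \<in> J" for t j
      using dyn[OF that(1)] that(2) param[OF that(2)]
      by (cases "kind D j") (force simp: component_dynamics_def J_def z_def d_def)+
    show "(\<Sum>j\<in>J. param D j * (d s j - d t j) * (z s j - z t j)) \<le> - \<mu> * (norm (x s - x t))\<^sup>2"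
      if st: "s > 0" "t > 0" for s t
    proof -
      obtain e e' where "kvl D (v s) (x s) e" "kvl D (v t) (x t) e'" using kvl st by metis
      then have "(\<Sum>j\<in>J. (v s j - v t j) * (i s j - i t j)) \<le> - \<mu> * (norm (x s - x t))\<^sup>2"
        unfolding J_def using st y kcl res by (intro storage_power_bound[OF assms(3,6)]) auto
      \<comment> \<open>For an inductor \<open>z\<close> is the current and
        \<open>param D j * d\<close> the voltage, for a capacitor the reverse; the product is the
        same power.\<close>
      moreover have "param D j * (d s j - d t j) * (z s j - z t j) = (v s j - v t j) * (i s j - i t j)"
        if "j \<in> J" for j
      proof -
        have "param D j * (d s j - d t j) = (if kind D j = Inductor then v s j - v t j else i s j - i t j)"
          using param[OF that] by (simp add: d_def right_diff_distrib)
        then show ?thesis by (simp add: z_def)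
      qed
      ultimately show ?thesis by simp
    qed
    show "(\<Sum>j\<in>J. param D j * d t j * (z t j - zs j)) \<le> - \<mu> * (norm (x t - xs))\<^sup>2"
      if t: "t > 0" for t
    proof -
      obtain e where "kvl D (v t) (x t) e" using kvl t by metis
      then have "(\<Sum>j\<in>J. (v t j - vs j) * (i t j - is j)) \<le> - \<mu> * (norm (x t - xs))\<^sup>2"
        unfolding J_def using t y ys kcl kcls kvls res ress
        by (intro storage_power_bound[OF assms(3,6)]) auto
      \<comment> \<open>At equilibrium inductor voltages and capacitor currents are zero, so nothing
        is subtracted from \<open>d\<close>.\<close>
      moreover have "param D j * d t j * (z t j - zs j) = (v t j - vs j) * (i t j - is j)"
        if j: "j \<in> J" for j
        using param[OF j] static[of j] j
        by (cases "kind D j") (auto simp: d_def z_def zs_def J_def)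
      ultimately show ?thesis by simp
    qed
  qed (use assms(1) param in auto)
  moreover have "(y \<longlongrightarrow> ys) at_top"
  proof -
    \<comment> \<open>Convergence of \<open>x\<close> passes to \<open>y\<close> because
      subgradients of \<open>f\<close> depend on the point in a Lipschitz way.\<close>
    have "((\<lambda>t. M * norm (x t - xs)) \<longlongrightarrow> 0) at_top"
      using tendsto_mult_right_zero[OF tendsto_norm_zero[OF LIM_zero[OF \<open>(x \<longlongrightarrow> xs) at_top\<close>]]] .
    moreover have "\<forall>\<^sub>F t in at_top. norm (y t - ys) \<le> M * norm (x t - xs)"
      using eventually_gt_at_top[of 0]
      by eventually_elim (intro smooth_subgradient_Lipschitz[OF assms(4)] y ys)
    ultimately have "((\<lambda>t. y t - ys) \<longlongrightarrow> 0) at_top"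
      by (rule Lim_null_comparison[rotated])
    then show ?thesis by (rule LIM_zero_cancel)
  qed
  ultimately show ?thesis by (rule tendsto_Pair)
qed

end
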